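(* Let $\mathcal H$ be a reproducing kernel Hilbert space (RKHS) of real-valued functions on $\mathcal W\times\mathcal S$ with kernel $K_{\mathcal H}$, let $\mathcal Q$ be an RKHS of real-valued functions on $\mathcal Z\times\mathcal S$ with kernel $K_{\mathcal Q}$, let $\lambda_Q,\lambda_H>0$, and let $(Z_j,S_j,W_j,A_j)$, $j=1,\dots,N$, be data points with $Z_j\in\mathcal Z$, $S_j\in\mathcal S$, $W_j\in\mathcal W$, $A_j\in\mathcal A=\{1,\dots,K\}$. Fix $a\in\mathcal A$, put $Y_j^{(a)}=\mathbb I\{A_j=a\}$ and $y_a:=(Y_1^{(a)},\dots,Y_N^{(a)})^\top$, and consider $$\widehat h_a\in\arg\min_{h\in\mathcal H}\ \sup_{q\in\mathcal Q}\Big\{\frac1N\sum_{j=1}^N\Big[\big(Y_j^{(a)}-h(W_j,S_j)\big)\,q(Z_j,S_j)-q(Z_j,S_j)^2\Big]-\lambda_Q\|q\|_{\mathcal Q}^2+\lambda_H\|h\|_{\mathcal H}^2\Big\}.$$ Let $K_H,K_Q\in\mathbb R^{N\times N}$ be the empirical kernel matrices $(K_H)_{ij}=K_{\mathcal H}\big((W_i,S_i),(W_j,S_j)\big)$ and $(K_Q)_{ij}=K_{\mathcal Q}\big((Z_i,S_i),(Z_j,S_j)\big)$, and define $$\Gamma:=\tfrac14\,K_Q\Big(\tfrac1N K_Q+\lambda_Q I_N\Big)^{-1}.$$ Then $\widehat h_a$ admits the representation $$\widehat h_a(w,s)=\sum_{j=1}^N\alpha_{a,j}\,K_{\mathcal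 H}\big((W_j,S_j),(w,s)\big),$$ with coefficient vector $\alpha_a=(\alpha_{a,1},\dots,\alpha_{a,N})^\top\in\mathbb R^N$ given by $$\alpha_a=\big(K_H\Gamma K_H+N^2\lambda_H K_H\big)^{\dagger}\,K_H\Gamma\,y_a,$$ where $(\cdot)^\dagger$ denotes the Moore--Penrose pseudoinverse.
   Context: $\mathbb I\{\cdot\}$ is the indicator function, $I_N$ the $N\times N$ identity matrix, and $\|\cdot\|_{\mathcal H},\|\cdot\|_{\mathcal Q}$ the RKHS norms. *)

theory Defs
  imports "HOL-Analysis.Analysis"
begin

definition ip_norm :: "(('x \<Rightarrow> real) \<Rightarrow> ('x \<Rightarrow> real) \<Rightarrow> real) \<Rightarrow> ('x \<Rightarrow> real) \<Rightarrow> real"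
  where "ip_norm ip f = sqrt (ip f f)"

(* Real Hilbert spaces of functions with the pointwise vector space operations. The space is the
   carrier F; nothing is assumed about ip outside of F. *)
locale function_hilbert_space =
  fixes F :: "('x \<Rightarrow> real) set"
    and ip :: "('x \<Rightarrow> real) \<Rightarrow> ('x \<Rightarrow> real) \<Rightarrow> real"
  assumes zero_mem: "(\<lambda>x. 0) \<in> F"
    and add_mem: "\<lbrakk>f \<in> F; g \<in> F\<rbrakk> \<Longrightarrow> (\<lambda>x. f x + g x) \<in> F"
    and scale_mem: "f \<in> F \<Longrightarrow> (\<lambda>x. c * f x) \<in> F"
    and ip_commute: "\<lbrakk>f \<in> F; g \<in> F\<rbrakk> \<Longrightarrow> ip f g = ip g f"
    and ip_add_left: "\<lbrakk>f \<in> F; g \<in> F; h \<in> F\<rbrakk> \<Longrightarrow> ip (\<lambda>x. f x + g x) h = ip f h + ip g h"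
    and ip_scale_left: "\<lbrakk>f \<in> F; g \<in> F\<rbrakk> \<Longrightarrow> ip (\<lambda>x. c * f x) g = c * ip f g"
    and ip_nonneg: "f \<in> F \<Longrightarrow> 0 \<le> ip f f"
    and ip_eq_zero: "\<lbrakk>f \<in> F; ip f f = 0\<rbrakk> \<Longrightarrow> f = (\<lambda>x. 0)"
    and complete: "\<lbrakk>\<And>n. X n \<in> F;
        \<And>e. 0 < e \<Longrightarrow> \<exists>M. \<forall>m\<ge>M. \<forall>n\<ge>M. ip_norm ip (\<lambda>x. X m x - X n x) < e\<rbrakk>
        \<Longrightarrow> \<exists>f\<in>F. (\<lambda>n::nat. ip_norm ip (\<lambda>x. X n x - f x)) \<longlonglongrightarrow> 0"

locale rkhs = function_hilbert_space F ip
  for F :: "('x \<Rightarrow> real) set" and ip :: "('x \<Rightarrow> real) \<Rightarrow> ('x \<Rightarrow> real) \<Rightarrow> real" +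
  fixes K :: "'x \<Rightarrow> 'x \<Rightarrow> real"
  assumes kernel_mem: "K x \<in> F"
    and reproducing: "f \<in> F \<Longrightarrow> ip f (K x) = f x"

definition kernel_matrix :: "('x \<Rightarrow> 'x \<Rightarrow> real) \<Rightarrow> ('n \<Rightarrow> 'x) \<Rightarrow> real^'n^'n"
  where "kernel_matrix K x = (\<chi> i j. K (x i) (x j))"

definition is_moore_penrose :: "real^'n^'m \<Rightarrow> real^'m^'n \<Rightarrow> bool"
  where "is_moore_penrose A B \<longleftrightarrow>
    A ** B ** A = A \<and> B ** A ** B = B \<and>
    transpose (A ** B) = A ** B \<and> transpose (B ** A) = B ** A"

definition moore_penrose :: "real^'n^'m \<Rightarrow> real^'m^'n"
  where "moore_penrose A = (THE B. is_moore_penrose A B)"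

lemma matrix_gram_cancel:
  fixes A :: "real^'n^'m" and X Y :: "real^'k^'n"
  assumes "transpose A ** (A ** X) = transpose A ** (A ** Y)"
  shows "A ** X = A ** Y"
proof -
  have "A *v (X *v v) = A *v (Y *v v)" for v
  proof -
    define w where "w = A *v (X *v v) - A *v (Y *v v)"
    have w: "w = A *v (X *v v - Y *v v)"
      by (simp add: w_def matrix_vector_mult_diff_distrib)
    have "transpose A *v w = 0"
      using arg_cong[OF assms, of "\<lambda>M. M *v v"]
      by (simp add: w_def matrix_vector_mult_diff_distrib flip: matrix_vector_mul_assoc)
    then have "w \<bullet> w = 0"
      using dot_lmul_matrix[of w A "X *v v - Y *v v"] w by simp
    then show ?thesis by (simp add: w_def)
  qed
  then show ?thesis by (simp add: matrix_eq flip: matrix_vector_mul_assoc)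
qed

lemma matrix_inner_inverse:
  fixes M :: "real^'n^'m"
  shows "\<exists>G :: real^'m^'n. M ** G ** M = M"
proof -
  obtain g where g: "linear g" "\<And>v. M *v (g (M *v v)) = M *v v"
    using linear_exists_right_inverse_on[of "(*v) M" UNIV] by auto
  have "(M ** matrix g ** M) *v v = M *v v" for v
    using g by (simp add: matrix_works flip: matrix_vector_mul_assoc)
  then have "M ** matrix g ** M = M" by (simp add: matrix_eq)
  then show ?thesis by blast
qed

lemma moore_penrose_exists:
  fixes A :: "real^'n^'m"
  shows "\<exists>B. is_moore_penrose A B"
proof -
  let ?T = "transpose A"
  note trans = matrix_transpose_mul and assoc = matrix_mul_assoc
  obtain G where G: "(?T ** A ** ?T) ** G ** (?T ** A ** ?T) = ?T ** A ** ?T"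
    using matrix_inner_inverse by blast
  define B where "B = ?T ** G ** ?T"
  have "?T ** (A ** (B ** A ** ?T)) = ?T ** (A ** ?T)"
    using G by (simp add: B_def assoc)
  then have "A ** (B ** A ** ?T) = A ** ?T" by (rule matrix_gram_cancel)
  then have "transpose (A ** (B ** A ** ?T)) = transpose (A ** ?T)" by simp
  then have "transpose ?T ** (?T ** (transpose B ** ?T)) = transpose ?T ** (?T ** mat 1)"
    by (simp add: trans assoc)
  then have "?T ** (transpose B ** ?T) = ?T ** mat 1" by (rule matrix_gram_cancel)
  then have tABA: "?T ** transpose B ** ?T = ?T" by (simp add: assoc)
  then have ABA: "A ** B ** A = A"
    by (metis trans assoc transpose_transpose)
  have "A ** B ** transpose (A ** B) = A ** B"
    using tABA by (metis B_def trans assoc)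
  then have AB: "transpose (A ** B) = A ** B"
    by (metis trans transpose_transpose)
  have "transpose (B ** A) ** (B ** A) = B ** A"
    using tABA by (metis B_def trans assoc)
  then have BA: "transpose (B ** A) = B ** A"
    by (metis trans transpose_transpose)
  have "B ** A ** ?T = ?T"
    using BA tABA by (metis trans assoc)
  then have "B ** A ** B = B"
    by (metis B_def assoc)
  then show ?thesis
    using ABA AB BA by (auto simp: is_moore_penrose_def)
qed

lemma moore_penrose_unique:
  assumes "is_moore_penrose A B" "is_moore_penrose A C"
  shows "B = C"
proof -
  note trans = matrix_transpose_mul and assoc = matrix_mul_assoc
  have "A ** B = A ** C"
    using assms unfolding is_moore_penrose_def by (metis trans assoc)
  moreover have "B ** A = C ** A"
    using assms unfolding is_moore_penrose_def by (metis trans assoc)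
  ultimately show ?thesis
    using assms unfolding is_moore_penrose_def by (metis assoc)
qed

lemma is_moore_penrose_moore_penrose: "is_moore_penrose A (moore_penrose A)"
  unfolding moore_penrose_def
  using moore_penrose_exists moore_penrose_unique by (metis theI)

end

theory Submission
  imports Defs
begin

text \<open>Since the pairing with \<open>\<Sum>\<^sub>j v\<^sub>j K(x\<^sub>j, \<cdot>)\<close> is \<open>\<Sum>\<^sub>j v\<^sub>j f(x\<^sub>j)\<close>, completing the square in
  \<open>q\<close> shows that the inner supremum equals \<open>N\<^sup>-\<^sup>2 u \<bullet> \<Gamma> u\<close>, where \<open>u\<close> is the vector of
  residuals of \<open>h\<close>. Any \<open>\<alpha>\<close> with \<open>(K\<^sub>H \<Gamma> K\<^sub>H + N\<^sup>2 \<lambda>\<^sub>H K\<^sub>H) \<alpha> = K\<^sub>H \<Gamma> y\<close> makes the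
  first variation of the outer objective vanish at \<open>g = \<Sum>\<^sub>j \<alpha>\<^sub>j K\<^sub>\<H>(x\<^sub>j, \<cdot>)\<close>: a vector in the
  kernel of \<open>K\<^sub>H\<close> is orthogonal to the values of every function in the space. The objective at
  \<open>h\<close> then exceeds the one at \<open>g\<close> by at least \<open>\<lambda>\<^sub>H \<parallel>h - g\<parallel>\<^sup>2\<close>. The pseudoinverse solves the equation
  because its kernel is that of \<open>K\<^sub>H\<close>, to which \<open>K\<^sub>H \<Gamma> y\<close> is orthogonal.\<close>

section \<open>Symmetric matrices and solvability through the pseudoinverse\<close>

lemma inner_matrix_vector_mult:
  fixes M :: "real^'n^'m"
  shows "v \<bullet> (M *v w) = (transpose M *v v) \<bullet> w"
  by (simp add: dot_lmul_matrix)

lemma inner_symmetric_matrix_vector_mult: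
  fixes M :: "real^'n^'n"
  assumes "transpose M = M"
  shows "v \<bullet> (M *v w) = (M *v v) \<bullet> w"
  using inner_matrix_vector_mult[of v M w] assms by simp

text \<open>The product of \<open>M\<close> with its pseudoinverse is an orthogonal projection
  \<open>P\<close>. The residual of \<open>b\<close> under \<open>P\<close> lies in the kernel of
  \<open>M\<close>, so it is orthogonal both to \<open>b\<close> and to \<open>P *v b\<close>, hence
  to itself.\<close>

lemma moore_penrose_solves:
  fixes M :: "real^'n^'n"
  assumes sym: "transpose M = M" and orth: "\<And>r. M *v r = 0 \<Longrightarrow> r \<bullet> b = 0"
  shows "M *v (moore_penrose M *v b) = b"
proof -
  define P where "P = M ** moore_penrose M"
  have "P ** M = M" "transpose P = P"
    using is_moore_penrose_moore_penrose[of M] by (auto simp: is_moore_penrose_def P_def)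
  \<comment> \<open>Transpose of \<open>P ** M = M\<close>, both factors being symmetric.\<close>
  then have MP: "M ** P = M"
    by (metis matrix_transpose_mul sym)
  define r where "r = b - P *v b"
  have Mr: "M *v r = 0"
    by (simp add: r_def matrix_vector_mult_diff_distrib matrix_vector_mul_assoc MP)
  have "r \<bullet> (P *v b) = (M *v r) \<bullet> (moore_penrose M *v b)"
    by (simp add: P_def inner_symmetric_matrix_vector_mult[OF sym] flip: matrix_vector_mul_assoc)
  with orth[OF Mr] Mr have "r \<bullet> r = 0"
    by (simp add: r_def inner_diff_right)
  then show ?thesis
    by (simp add: r_def P_def matrix_vector_mul_assoc)
qed

section \<open>The regularised kernel matrix and its hat matrix\<close>

definition ridge :: "real \<Rightarrow> real \<Rightarrow> real^'n^'n \<Rightarrow> real^'n^'n"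
  where "ridge c l G = c *\<^sub>R G + l *\<^sub>R mat 1"

text \<open>With \<open>c = 1/N\<close>, \<open>l = lam\<^sub>Q\<close> and
  \<open>G = K\<^sub>Q\<close> this is the \<Gamma> of the theorem.\<close>

definition ridge_hat :: "real \<Rightarrow> real \<Rightarrow> real^'n^'n \<Rightarrow> real^'n^'n"
  where "ridge_hat c l G = (1/4) *\<^sub>R (G ** matrix_inv (ridge c l G))"

lemma ridge_vec: "ridge c l G *v v = c *\<^sub>R (G *v v) + l *\<^sub>R v"
  by (simp add: ridge_def matrix_vector_mult_add_rdistrib scaleR_matrix_vector_assoc[symmetric])

lemma ridge_commute: "ridge c l G ** G = G ** ridge c l G"
  by (simp add: matrix_eq ridge_vec matrix_vector_right_distrib matrix_vector_mult_scaleR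
      flip: matrix_vector_mul_assoc)

text \<open>Pairing a null vector \<open>v\<close> with its image writes zero as a sum of
  nonnegative terms, one of them \<open>l * (v \<bullet> v)\<close>; so the square matrix is
  injective.\<close>

lemma ridge_inverse:
  fixes G :: "real^'n^'n"
  assumes "\<And>v. 0 \<le> v \<bullet> (G *v v)" "0 < c" "0 < l"
  shows "ridge c l G ** matrix_inv (ridge c l G) = mat 1"
    and "matrix_inv (ridge c l G) ** ridge c l G = mat 1"
proof -
  have "v = 0" if "ridge c l G *v v = 0" for v
  proof -
    have "c * (v \<bullet> (G *v v)) + l * (v \<bullet> v) = v \<bullet> (ridge c l G *v v)"
      by (simp add: ridge_vec inner_add_right)
    with that assms have "l * (v \<bullet> v) \<le> 0"
      by (smt (verit) inner_zero_right mult_nonneg_nonneg)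
    with assms(3) have "v \<bullet> v \<le> 0"
      by (simp add: mult_le_0_iff)
    then show ?thesis
      using inner_gt_zero_iff[of v] by linarith
  qed
  then have "invertible (ridge c l G)"
    by (metis invertible_left_inverse matrix_left_invertible_ker)
  then have "\<exists>B. ridge c l G ** B = mat 1 \<and> B ** ridge c l G = mat 1"
    by (simp add: invertible_def)
  from someI_ex[OF this]
  show "ridge c l G ** matrix_inv (ridge c l G) = mat 1"
    and "matrix_inv (ridge c l G) ** ridge c l G = mat 1"
    by (simp_all add: matrix_inv_def)
qed

lemma ridge_solve:
  fixes G :: "real^'n^'n"
  assumes "\<And>v. 0 \<le> v \<bullet> (G *v v)" "0 < c" "0 < l"
  defines "w \<equiv> \<lambda>u. matrix_inv (ridge c l G) *v u"
  shows "c *\<^sub>R (G *v w u) + l *\<^sub>R w u = u"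
proof -
  have "ridge c l G *v w u = u"
    using ridge_inverse(1)[OF assms(1-3)] by (simp add: w_def matrix_vector_mul_assoc)
  then show ?thesis
    by (simp add: ridge_vec)
qed

text \<open>\<open>G\<close> commutes with its ridge matrix, hence with the inverse of that matrix,
  and a product of commuting symmetric matrices is symmetric.\<close>

lemma ridge_hat_symmetric:
  fixes G :: "real^'n^'n"
  assumes sym: "transpose G = G" and psd: "\<And>v. 0 \<le> v \<bullet> (G *v v)" and "0 < c" "0 < l"
  shows "transpose (ridge_hat c l G) = ridge_hat c l G"
proof -
  define C B where "C = ridge c l G" and "B = matrix_inv C"
  have CB: "C ** B = mat 1" and BC: "B ** C = mat 1"
    using ridge_inverse[OF psd assms(3,4)] by (simp_all add: C_def B_def)
  have C: "transpose C = C"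
    using sym by (simp add: C_def ridge_def vec_eq_iff transpose_def mat_def)
  have "C ** transpose B = mat 1"
    by (metis BC C matrix_transpose_mul transpose_mat)
  then have B: "transpose B = B"
    by (metis BC matrix_mul_assoc matrix_mul_lid matrix_mul_rid)
  have "B ** (C ** G) ** B = B ** (G ** C) ** B"
    by (simp add: C_def ridge_commute)
  then have "B ** G = G ** B"
    by (metis BC CB matrix_mul_assoc matrix_mul_lid matrix_mul_rid)
  then have "transpose (G ** B) = G ** B"
    by (simp add: matrix_transpose_mul sym B)
  moreover have "transpose (r *\<^sub>R X) = r *\<^sub>R transpose X" for r :: real and X :: "real^'n^'n"
    by (simp add: vec_eq_iff transpose_def)
  ultimately show ?thesis
    by (simp add: ridge_hat_def C_def B_def)
qed

text \<open>Expressing \<open>u\<close> through the solution \<open>w\<close> of the ridge system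
  turns the form into a positive combination of \<open>(G *v w) \<bullet> (G *v w)\<close> and
  \<open>w \<bullet> (G *v w)\<close>.\<close>

lemma ridge_hat_nonneg:
  fixes G :: "real^'n^'n"
  assumes sym: "transpose G = G" and psd: "\<And>v. 0 \<le> v \<bullet> (G *v v)" and "0 < c" "0 < l"
  shows "0 \<le> u \<bullet> (ridge_hat c l G *v u)"
proof -
  define w where "w = matrix_inv (ridge c l G) *v u"
  have u: "u = c *\<^sub>R (G *v w) + l *\<^sub>R w"
    using ridge_solve[OF psd assms(3,4)] by (simp add: w_def)
  have hat: "u \<bullet> (ridge_hat c l G *v u) = (1/4) * (u \<bullet> (G *v w))"
    by (simp add: ridge_hat_def w_def matrix_vector_mul_assoc scaleR_matrix_vector_assoc[symmetric])
  have "u \<bullet> (G *v w) = c * ((G *v w) \<bullet> (G *v w)) + l * (w \<bullet> (G *v w))"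
    by (subst u) (simp add: inner_add_left)
  also have "0 \<le> \<dots>"
    using psd[of w] assms(3,4) by simp
  finally show ?thesis
    by (simp add: hat)
qed

context function_hilbert_space
begin

lemma diff_mem: "f \<in> F \<Longrightarrow> g \<in> F \<Longrightarrow> (\<lambda>t. f t - g t) \<in> F"
  using add_mem[OF _ scale_mem[of g "-1"], of f] by simp

lemma ip_add_right:
  "\<lbrakk>f \<in> F; g \<in> F; h \<in> F\<rbrakk> \<Longrightarrow> ip f (\<lambda>x. g x + h x) = ip f g + ip f h"
  using ip_add_left[of g h f] by (simp add: ip_commute add_mem)

lemma ip_scale_right: "\<lbrakk>f \<in> F; g \<in> F\<rbrakk> \<Longrightarrow> ip f (\<lambda>x. c * g x) = c * ip f g"
  using ip_scale_left[of g f c] by (simp add: ip_commute scale_mem)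

lemma ip_zero_right: "f \<in> F \<Longrightarrow> ip f (\<lambda>x. 0) = 0"
  using ip_scale_right[of f f 0] by simp

lemma ip_add_self:
  assumes "f \<in> F" "g \<in> F"
  shows "ip (\<lambda>x. f x + g x) (\<lambda>x. f x + g x) = ip f f + 2 * ip g f + ip g g"
  using assms by (simp add: ip_add_left ip_add_right add_mem ip_commute[of f g])

lemma ip_norm_power2: "f \<in> F \<Longrightarrow> (ip_norm ip f)\<^sup>2 = ip f f"
  by (simp add: ip_norm_def ip_nonneg)

end

section \<open>Evaluation at the data points and finite kernel expansions\<close>

definition sample :: "('n \<Rightarrow> 'x) \<Rightarrow> ('x \<Rightarrow> real) \<Rightarrow> real^'n"
  where "sample x f = (\<chi> j. f (x j))"

lemma sample_nth [simp]: "sample x f $ j = f (x j)"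
  by (simp add: sample_def)

lemma sample_add: "sample x (\<lambda>t. f t + g t) = sample x f + sample x g"
  by (simp add: sample_def vec_eq_iff)

text \<open>In an RKHS this is the adjoint of \<open>sample\<close>, as \<open>ip_kernel_sum\<close>
  shows.\<close>

definition kernel_sum :: "('x \<Rightarrow> 'x \<Rightarrow> real) \<Rightarrow> ('n \<Rightarrow> 'x) \<Rightarrow> real^'n \<Rightarrow> 'x \<Rightarrow> real"
  where "kernel_sum K x v = (\<lambda>t. \<Sum>j\<in>UNIV. v $ j * K (x j) t)"

context rkhs
begin

text \<open>Membership and the pairing formula go through one induction because additivity of
  \<open>ip\<close> is available only inside \<open>F\<close>.\<close>

lemma kernel_sum_aux:
  assumes "finite I"
  shows "(\<lambda>t. \<Sum>j\<in>I. c j * K (x j) t) \<in> F \<and>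
    (\<forall>f\<in>F. ip f (\<lambda>t. \<Sum>j\<in>I. c j * K (x j) t) = (\<Sum>j\<in>I. c j * f (x j)))"
  using assms
proof (induction I)
  case empty
  then show ?case by (simp add: zero_mem ip_zero_right)
next
  case (insert i I)
  then show ?case
    by (simp add: add_mem scale_mem kernel_mem ip_add_right ip_scale_right reproducing)
qed

lemma kernel_sum_mem: "kernel_sum K x v \<in> F" for v :: "real^'n"
  using kernel_sum_aux[of UNIV "($) v" x] by (simp add: kernel_sum_def)

lemma ip_kernel_sum: "f \<in> F \<Longrightarrow> ip f (kernel_sum K x v) = v \<bullet> sample x f" for v :: "real^'n"
  using kernel_sum_aux[of UNIV "($) v" x] by (simp add: kernel_sum_def inner_vec_def)

lemma kernel_commute: "K s t = K t s"
  using reproducing[of "K s" t] reproducing[of "K t" s] ip_commute[of "K s" "K t"]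
  by (simp add: kernel_mem)

lemma transpose_kernel_matrix: "transpose (kernel_matrix K x) = kernel_matrix K x"
  by (simp add: kernel_matrix_def transpose_def vec_eq_iff) (metis kernel_commute)

lemma sample_kernel_sum: "sample x (kernel_sum K x v) = kernel_matrix K x *v v"
  for v :: "real^'n"
  by (auto simp: kernel_matrix_def matrix_vector_mult_def vec_eq_iff kernel_sum_def mult.commute
      kernel_commute intro!: sum.cong)

lemma ip_kernel_sum_self:
  "ip (kernel_sum K x v) (kernel_sum K x v) = v \<bullet> (kernel_matrix K x *v v)" for v :: "real^'n"
  by (simp add: ip_kernel_sum kernel_sum_mem sample_kernel_sum)

lemma kernel_matrix_nonneg: "0 \<le> v \<bullet> (kernel_matrix K x *v v)" for v :: "real^'n"
  using ip_nonneg[OF kernel_sum_mem, of x v] by (simp add: ip_kernel_sum_self)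

text \<open>The quadratic form is the squared norm of \<open>kernel_sum K x v\<close>; when it
  vanishes this function is zero, and so is its pairing with \<open>f\<close>.\<close>

lemma inner_sample_eq_0:
  fixes v :: "real^'n"
  assumes "f \<in> F" "v \<bullet> (kernel_matrix K x *v v) = 0"
  shows "v \<bullet> sample x f = 0"
proof -
  have "kernel_sum K x v = (\<lambda>t. 0)"
    using assms(2) by (intro ip_eq_zero) (simp_all add: kernel_sum_mem ip_kernel_sum_self)
  then show ?thesis
    using ip_kernel_sum[OF assms(1), of x v] ip_zero_right[OF assms(1)] by simp
qed

text \<open>The rows of the kernel matrix are the samples of the functions
  \<open>K (x j)\<close>.\<close>

lemma kernel_matrix_null:
  fixes v :: "real^'n"
  assumes "v \<bullet> (kernel_matrix K x *v v) = 0"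
  shows "kernel_matrix K x *v v = 0"
proof -
  have "v \<bullet> sample x (K (x j)) = 0" for j
    using inner_sample_eq_0[OF kernel_mem assms] .
  then show ?thesis
    by (simp add: vec_eq_iff kernel_matrix_def matrix_vector_mult_def inner_vec_def mult.commute)
qed

text \<open>The supremum is attained at \<open>kernel_sum K x \<beta>\<close> with \<open>\<beta> = (c/2) (c G + l I)\<^sup>-\<^sup>1 u\<close>.\<close>

lemma SUP_penalized:
  fixes u :: "real^'n" and x :: "'n \<Rightarrow> 'x"
  assumes c: "0 < c" and l: "0 < l"
  defines "G \<equiv> kernel_matrix K x"
  shows "(SUP q\<in>F. ereal (c * (\<Sum>j\<in>UNIV. u $ j * q (x j) - (q (x j))\<^sup>2) - l * (ip_norm ip q)\<^sup>2 + R))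
    = ereal (c\<^sup>2 * (u \<bullet> (ridge_hat c l G *v u)) + R)" (is "(SUP q\<in>F. ereal (?J q)) = ereal ?v")
proof -
  define w where "w = matrix_inv (ridge c l G) *v u"
  define q0 where "q0 = kernel_sum K x ((c/2) *\<^sub>R w)"
  define g where "g = (c/2) *\<^sub>R (G *v w)"
  have psd: "\<And>v. 0 \<le> v \<bullet> (G *v v)"
    by (simp add: G_def kernel_matrix_nonneg)
  have u: "u = c *\<^sub>R (G *v w) + l *\<^sub>R w"
    using ridge_solve[OF psd c l] by (simp add: w_def)
  then have cu: "c *\<^sub>R u = (2*c) *\<^sub>R g + (l*c) *\<^sub>R w"
    by (simp add: g_def algebra_simps)
  have q0: "q0 \<in> F" "sample x q0 = g"
    by (simp_all add: q0_def g_def kernel_sum_mem sample_kernel_sum G_def matrix_vector_mult_scaleR)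
  have ipq0: "ip f q0 = (c/2) * (w \<bullet> sample x f)" if "f \<in> F" for f
    using that by (simp add: q0_def ip_kernel_sum)
  have hat: "c\<^sup>2 * (u \<bullet> (ridge_hat c l G *v u)) = (c/2) * (u \<bullet> g)"
    by (simp add: ridge_hat_def w_def g_def matrix_vector_mul_assoc scaleR_matrix_vector_assoc[symmetric]
        power2_eq_square)
  \<comment> \<open>This is the stationarity of the penalised objective at \<open>q0\<close> in a
    direction with sample vector \<open>p\<close>.\<close>
  have cug: "c * (u \<bullet> p) = 2 * c * (g \<bullet> p) + l * c * (w \<bullet> p)" for p
    using arg_cong[OF cu, of "\<lambda>z. z \<bullet> p"] by (simp add: inner_add_left)
  \<comment> \<open>Expanded around \<open>q0\<close>, the objective has no linear term, and its
    quadratic part is minus a nonnegative form.\<close>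
  have J: "?J q = ?v - (c * (sample x p \<bullet> sample x p) + l * ip p p)"
    if q: "q \<in> F" and p: "p = (\<lambda>t. q t - q0 t)" for q p
  proof -
    have pF: "p \<in> F" using q q0 p by (simp add: diff_mem)
    have qp: "q = (\<lambda>t. q0 t + p t)" using p by simp
    have s: "sample x q = g + sample x p" by (simp add: qp sample_add q0)
    have "ip q q = (c/2) * (w \<bullet> g) + c * (w \<bullet> sample x p) + ip p p"
      unfolding qp by (simp add: ip_add_self q0 pF ipq0)
    then have ipq: "l * ip q q = (1/2) * (l * c * (w \<bullet> g)) + l * c * (w \<bullet> sample x p) + l * ip p p"
      by (simp add: algebra_simps)
    have sum: "(\<Sum>j\<in>UNIV. u $ j * q (x j) - (q (x j))\<^sup>2)
        = u \<bullet> sample x q - sample x q \<bullet> sample x q"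
      by (simp add: inner_vec_def sum_subtractf power2_eq_square)
    have "c * (\<Sum>j\<in>UNIV. u $ j * q (x j) - (q (x j))\<^sup>2) = c * (u \<bullet> g) + c * (u \<bullet> sample x p)
        - c * (g \<bullet> g) - 2 * c * (g \<bullet> sample x p) - c * (sample x p \<bullet> sample x p)"
      unfolding sum by (simp add: s inner_add_left inner_add_right
          inner_commute[of "sample x p" g] algebra_simps)
    \<comment> \<open>The instance at \<open>g\<close> evaluates the objective at \<open>q0\<close>;
      the instance at \<open>sample x p\<close> cancels the cross terms.\<close>
    then show ?thesis
      using ipq cug[of g] cug[of "sample x p"]
      unfolding ip_norm_power2[OF q] hat by linarith
  qed
  show ?thesis
  proof (rule antisym)
    show "(SUP q\<in>F. ereal (?J q)) \<le> ereal ?v"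
    proof (rule SUP_least)
      fix q assume q: "q \<in> F"
      define p where "p = (\<lambda>t. q t - q0 t)"
      have "0 \<le> c * (sample x p \<bullet> sample x p)" "0 \<le> l * ip p p"
        using q c l by (simp_all add: p_def ip_nonneg diff_mem q0)
      then show "ereal (?J q) \<le> ereal ?v"
        unfolding J[OF q p_def] by simp
    qed
    have "sample x (\<lambda>t. 0) = 0"
      by (simp add: vec_eq_iff)
    then have "?J q0 = ?v"
      using J[OF q0(1) refl] by (simp add: ip_zero_right zero_mem)
    then show "ereal ?v \<le> (SUP q\<in>F. ereal (?J q))"
      by (metis (mono_tags, lifting) SUP_upper q0(1))
  qed
qed

section \<open>The outer minimisation and its normal equation\<close>

text \<open>At a solution \<alpha> of the normal equation the increment of \<open>E\<close> along
  \<open>d\<close> is \<open>e \<bullet> (\<Gamma> *v e) + l * ip d d\<close>, so a competitor that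
  does no worse has \<open>d = 0\<close>.\<close>

lemma penalized_quadratic_minimizer:
  fixes l :: real and y \<alpha> :: "real^'n" and \<Gamma> :: "real^'n^'n" and x :: "'n \<Rightarrow> 'x"
  defines "G \<equiv> kernel_matrix K x"
    and "E \<equiv> \<lambda>f. (y - sample x f) \<bullet> (\<Gamma> *v (y - sample x f)) + l * ip f f"
  assumes sym: "transpose \<Gamma> = \<Gamma>" and psd: "\<And>v. 0 \<le> v \<bullet> (\<Gamma> *v v)" and l: "0 < l"
    and \<alpha>: "(G ** \<Gamma> ** G + l *\<^sub>R G) *v \<alpha> = (G ** \<Gamma>) *v y"
    and h: "h \<in> F" "E h \<le> E (kernel_sum K x \<alpha>)"
  shows "h = kernel_sum K x \<alpha>"
proof -
  define g where "g = kernel_sum K x \<alpha>"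
  define d where "d = (\<lambda>t. h t - g t)"
  have g: "g \<in> F" "sample x g = G *v \<alpha>"
    by (simp_all add: g_def G_def kernel_sum_mem sample_kernel_sum)
  have d: "d \<in> F" "h = (\<lambda>t. g t + d t)"
    using h g by (simp_all add: d_def diff_mem)
  \<comment> \<open>Half the gradient of \<open>E\<close> at \<open>g\<close> is
    \<open>kernel_sum K x v\<close>. The normal equation says \<open>G *v v = 0\<close>;
    \<open>v\<close> itself may be nonzero when \<open>G\<close> is singular, yet it is orthogonal
    to every sample vector.\<close>
  define e v where "e = sample x d" and "v = l *\<^sub>R \<alpha> - \<Gamma> *v (y - G *v \<alpha>)"
  have "G *v v = 0"
    using \<alpha> by (simp add: v_def matrix_vector_mult_diff_distrib matrix_vector_mult_add_rdistrib
        matrix_vector_mult_scaleR scaleR_matrix_vector_assoc[symmetric] algebra_simps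
        flip: matrix_vector_mul_assoc)
  then have "v \<bullet> e = 0"
    unfolding e_def G_def by (intro inner_sample_eq_0[OF d(1)]) simp
  then have stationary: "l * (\<alpha> \<bullet> e) = e \<bullet> (\<Gamma> *v (y - G *v \<alpha>))"
    by (simp add: v_def inner_diff_left inner_commute[of _ e] inner_diff_right)
  have cross: "(y - G *v \<alpha>) \<bullet> (\<Gamma> *v e) = e \<bullet> (\<Gamma> *v (y - G *v \<alpha>))"
    by (simp add: inner_symmetric_matrix_vector_mult[OF sym] inner_commute)
  have "ip h h = ip g g + 2 * (\<alpha> \<bullet> e) + ip d d"
    using d g by (simp add: ip_add_self e_def) (simp add: g_def ip_kernel_sum)
  moreover have "y - sample x h = (y - G *v \<alpha>) - e"
    by (simp add: d(2) sample_add g e_def)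
  ultimately have "E h = ((y - G *v \<alpha>) - e) \<bullet> (\<Gamma> *v ((y - G *v \<alpha>) - e))
      + l * (ip g g + 2 * (\<alpha> \<bullet> e) + ip d d)"
    by (simp only: E_def)
  also have "\<dots> = E g + e \<bullet> (\<Gamma> *v e) + l * ip d d"
    using stationary cross
    unfolding E_def g(2) matrix_vector_mult_diff_distrib[of _ _ e] inner_diff_left[of _ e]
      inner_diff_right distrib_left by simp
  finally have "E h = E g + e \<bullet> (\<Gamma> *v e) + l * ip d d" .
  with h(2) psd[of e] have "l * ip d d \<le> 0"
    by (simp add: g_def)
  with l ip_nonneg[OF d(1)] have "ip d d = 0"
    by (simp add: mult_le_0_iff)
  then have "d = (\<lambda>t. 0)"
    by (rule ip_eq_zero[OF d(1)])
  then show ?thesis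
    using d(2) by (simp add: g_def)
qed

text \<open>A null vector \<open>r\<close> of \<open>M l\<close> makes two nonnegative terms sum to
  zero, which forces \<open>G *v r = 0\<close> and hence orthogonality to the right-hand
  side.\<close>

lemma moore_penrose_kernel_solves:
  fixes y :: "real^'n" and \<Gamma> :: "real^'n^'n" and x :: "'n \<Rightarrow> 'x"
  defines "G \<equiv> kernel_matrix K x"
  defines "M \<equiv> \<lambda>l. G ** \<Gamma> ** G + l *\<^sub>R G"
  assumes sym: "transpose \<Gamma> = \<Gamma>" and psd: "\<And>v. 0 \<le> v \<bullet> (\<Gamma> *v v)" and l: "0 < l"
  shows "M l *v ((moore_penrose (M l) ** G ** \<Gamma>) *v y) = (G ** \<Gamma>) *v y"
proof -
  have G: "transpose G = G"
    by (simp add: G_def transpose_kernel_matrix)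
  have "transpose (G ** \<Gamma> ** G) = G ** \<Gamma> ** G"
    by (simp add: matrix_transpose_mul G sym matrix_mul_assoc)
  then have "transpose (M l) = M l"
    using G by (simp add: M_def vec_eq_iff transpose_def)
  moreover have "r \<bullet> ((G ** \<Gamma>) *v y) = 0" if r: "M l *v r = 0" for r
  proof -
    have "(G *v r) \<bullet> (\<Gamma> *v (G *v r)) + l * (r \<bullet> (G *v r)) = r \<bullet> (M l *v r)"
      by (simp add: M_def matrix_vector_mult_add_rdistrib inner_add_right
          scaleR_matrix_vector_assoc[symmetric] inner_symmetric_matrix_vector_mult[OF G, of r]
          flip: matrix_vector_mul_assoc)
    with r psd[of "G *v r"] have "l * (r \<bullet> (G *v r)) \<le> 0"
      by simp
    with l kernel_matrix_nonneg[of r x] have "r \<bullet> (G *v r) = 0"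
      by (simp add: mult_le_0_iff G_def)
    then have "G *v r = 0"
      unfolding G_def by (rule kernel_matrix_null)
    then show ?thesis
      by (simp add: inner_symmetric_matrix_vector_mult[OF G] flip: matrix_vector_mul_assoc)
  qed
  ultimately show ?thesis
    using moore_penrose_solves[of "M l" "(G ** \<Gamma>) *v y"]
    by (simp add: matrix_vector_mul_assoc matrix_mul_assoc)
qed

end

theorem proposition5p1:
  fixes \<H> :: "('w \<times> 's \<Rightarrow> real) set"
    and ip\<^sub>\<H> :: "('w \<times> 's \<Rightarrow> real) \<Rightarrow> ('w \<times> 's \<Rightarrow> real) \<Rightarrow> real"
    and K\<^sub>\<H> :: "'w \<times> 's \<Rightarrow> 'w \<times> 's \<Rightarrow> real"
    and \<Q> :: "('z \<times> 's \<Rightarrow> real) set"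
    and ip\<^sub>\<Q> :: "('z \<times> 's \<Rightarrow> real) \<Rightarrow> ('z \<times> 's \<Rightarrow> real) \<Rightarrow> real"
    and K\<^sub>\<Q> :: "'z \<times> 's \<Rightarrow> 'z \<times> 's \<Rightarrow> real"
    and lam\<^sub>Q lam\<^sub>H N :: real
    and Z :: "'n::finite \<Rightarrow> 'z" and S :: "'n \<Rightarrow> 's" and W :: "'n \<Rightarrow> 'w" and A :: "'n \<Rightarrow> nat"
    and K a :: nat
    and y \<alpha> :: "real^'n"
    and K\<^sub>H K\<^sub>Q \<Gamma> :: "real^'n^'n"
    and h :: "'w \<times> 's \<Rightarrow> real"
  defines "N \<equiv> real CARD('n)"
    and "y \<equiv> (\<chi> j. if A j = a then 1 else 0)"
    and "K\<^sub>H \<equiv> kernel_matrix K\<^sub>\<H> (\<lambda>j. (W j, S j))"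
    and "K\<^sub>Q \<equiv> kernel_matrix K\<^sub>\<Q> (\<lambda>j. (Z j, S j))"
    and "\<Gamma> \<equiv> (1/4) *\<^sub>R (K\<^sub>Q ** matrix_inv ((1/N) *\<^sub>R K\<^sub>Q + lam\<^sub>Q *\<^sub>R mat 1))"
    and "\<alpha> \<equiv> (moore_penrose (K\<^sub>H ** \<Gamma> ** K\<^sub>H + (N\<^sup>2 * lam\<^sub>H) *\<^sub>R K\<^sub>H) ** K\<^sub>H ** \<Gamma>) *v y"
  assumes "rkhs \<H> ip\<^sub>\<H> K\<^sub>\<H>" and "rkhs \<Q> ip\<^sub>\<Q> K\<^sub>\<Q>"
    and "lam\<^sub>Q > 0" and "lam\<^sub>H > 0"
    and "\<And>j. A j \<in> {1..K}" and "a \<in> {1..K}"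
    and "is_arg_min
      (\<lambda>h. SUP q\<in>\<Q>. ereal (
          (1/N) * (\<Sum>j\<in>UNIV. (y $ j - h (W j, S j)) * q (Z j, S j) - (q (Z j, S j))\<^sup>2)
          - lam\<^sub>Q * (ip_norm ip\<^sub>\<Q> q)\<^sup>2 + lam\<^sub>H * (ip_norm ip\<^sub>\<H> h)\<^sup>2))
      (\<lambda>h. h \<in> \<H>) h"
  shows "\<forall>w s. h (w, s) = (\<Sum>j\<in>UNIV. \<alpha> $ j * K\<^sub>\<H> (W j, S j) (w, s))"
proof -
  interpret H: rkhs \<H> ip\<^sub>\<H> K\<^sub>\<H> by fact
  interpret Q: rkhs \<Q> ip\<^sub>\<Q> K\<^sub>\<Q> by fact
  define x where "x = (\<lambda>j. (W j, S j))"
  \<comment> \<open>On the space this is \<open>N\<^sup>2\<close> times the outer objective, whence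
    the factor \<open>N\<^sup>2\<close> on \<open>lam\<^sub>H\<close>.\<close>
  define E where "E = (\<lambda>f. (y - sample x f) \<bullet> (\<Gamma> *v (y - sample x f)) + (N\<^sup>2 * lam\<^sub>H) * ip\<^sub>\<H> f f)"
  have N: "0 < N"
    by (simp add: N_def)
  have \<Gamma>: "\<Gamma> = ridge_hat (1/N) lam\<^sub>Q K\<^sub>Q"
    by (simp add: \<Gamma>_def ridge_hat_def ridge_def)
  have sym: "transpose \<Gamma> = \<Gamma>" and psd: "\<And>v. 0 \<le> v \<bullet> (\<Gamma> *v v)"
    unfolding \<Gamma> K\<^sub>Q_def using N \<open>lam\<^sub>Q > 0\<close>
    by (auto intro!: ridge_hat_symmetric ridge_hat_nonneg Q.transpose_kernel_matrix
        Q.kernel_matrix_nonneg)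
  define J where "J = (\<lambda>h. SUP q\<in>\<Q>. ereal (
          (1/N) * (\<Sum>j\<in>UNIV. (y $ j - h (W j, S j)) * q (Z j, S j) - (q (Z j, S j))\<^sup>2)
          - lam\<^sub>Q * (ip_norm ip\<^sub>\<Q> q)\<^sup>2 + lam\<^sub>H * (ip_norm ip\<^sub>\<H> h)\<^sup>2))"
  have J: "J f = ereal ((1/N)\<^sup>2 * E f)" if "f \<in> \<H>" for f
  proof -
    \<comment> \<open>The penalty on \<open>f\<close> does not depend on \<open>q\<close> and passes
      through the supremum as the constant \<open>R\<close>.\<close>
    have "J f = ereal ((1/N)\<^sup>2 * ((y - sample x f) \<bullet> (\<Gamma> *v (y - sample x f)))
        + lam\<^sub>H * (ip_norm ip\<^sub>\<H> f)\<^sup>2)"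
      using Q.SUP_penalized[of "1/N" lam\<^sub>Q "y - sample x f" "\<lambda>j. (Z j, S j)"] N \<open>lam\<^sub>Q > 0\<close>
      by (simp add: J_def \<Gamma> K\<^sub>Q_def x_def)
    with that N show ?thesis
      by (simp add: E_def H.ip_norm_power2 field_simps)
  qed
  have h: "h \<in> \<H>" "\<And>f. f \<in> \<H> \<Longrightarrow> \<not> J f < J h"
    using \<open>is_arg_min _ _ h\<close> by (auto simp: is_arg_min_def J_def)
  \<comment> \<open>Minimality of \<open>h\<close> is tested against the explicit candidate, which
    lies in the space.\<close>
  have le: "E h \<le> E (kernel_sum K\<^sub>\<H> x \<alpha>)"
    using h(2)[OF H.kernel_sum_mem, of x \<alpha>] N
    by (simp add: J h(1) H.kernel_sum_mem not_less divide_le_cancel)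
  have pos: "0 < N\<^sup>2 * lam\<^sub>H"
    using N \<open>lam\<^sub>H > 0\<close> by simp
  have "h = kernel_sum K\<^sub>\<H> x \<alpha>"
    using H.penalized_quadratic_minimizer[OF sym psd pos _ h(1)]
      H.moore_penrose_kernel_solves[OF sym psd pos, of x y] le
    unfolding E_def \<alpha>_def K\<^sub>H_def x_def by blast
  then show ?thesis
    by (simp add: kernel_sum_def x_def)
qed

end
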